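(* Let $\Omega_{\mathbb M}=\{(f,F,\lambda):|f|\le F,\ \lambda>0\}$. If $m:\Omega_{\mathbb M}\to\mathbb R$ is any supersolution, then $\mathbb M\le m$ on $\Omega_{\mathbb M}$.
   Context: $\mathcal D$ denotes the standard collection of dyadic intervals of $\mathbb R$. For $I\in\mathcal D$, $I_-$ and $I_+$ are its left and right halves, $\mathbf 1_I$ its indicator function, and $|E|$ denotes Lebesgue measure. For integrable $\varphi$, $\langle\varphi\rangle_I=\frac1{|I|}\int_I\varphi\,dx$. Functions are real-valued. For $J\in\mathcal D$ the (localized) dyadic square function is given by $$S_J^2\varphi(x)=\sum_{I\in\mathcal D,\ I\subseteq J}|\Delta_I\varphi|^2\,\mathbf 1_I(x),\qquad \Delta_I\varphi=\tfrac12\big(\langle\varphi\rangle_{I_+}-\langle\varphi\rangle_{I_-}\big)\big(\mathbf 1_{I_+}-\mathbf 1_{I_-}\big).$$ For $f\in\mathbb R$, $F\ge|f|$, $\lambda>0$, $$\mathbb M(f,F,\lambda)=\sup\frac1{|J|}|\{x\in J:S_J^2\varphi(x)\ge\lambda\}|,$$ the supremum being over all integrable $\varphi$ supported in $J\in\mathcal D$ with $\langle\varphi\rangle_J=f$ and $\langle|\varphi|\rangle_J=F$; it does not depend on the choice of $J$. A function $m(f,F,\lambda)$ on $\Omega_{\mathbb M}$ is a supersolution if it is non-negative, continuous, and satisfies: (1) the main inequality $$m(f,F,\lambda+a^2)\ \ge\ \tfrac12\big(m(f+a,F+b,\lambda)+m(f-a,F-b,\lambda)\big)$$ for all $f,F,\lambda,a,b$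 such that the points involved lie in $\Omega_{\mathbb M}$; (2) the obstacle condition $m(f,F,\lambda)=1$ whenever $(f,F,\lambda)\in\Omega_{\mathbb M}$ and $\lambda\le F^2$. *)

theory Defs
  imports "HOL-Analysis.Analysis"
begin

definition dyadic_intervals :: "real set set" where
  "dyadic_intervals =
     {{of_int k * 2 powi n ..< (of_int k + 1) * 2 powi n} | (k::int) (n::int). True}"

definition left_half :: "real set \<Rightarrow> real set" where
  "left_half I = {Inf I ..< (Inf I + Sup I) / 2}"

definition right_half :: "real set \<Rightarrow> real set" where
  "right_half I = {(Inf I + Sup I) / 2 ..< Sup I}"

definition avg :: "real set \<Rightarrow> (real \<Rightarrow> real) \<Rightarrow> real" where
  "avg I \<phi> = (LINT x:I|lebesgue. \<phi> x) / measure lebesgue I"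

definition martingale_diff :: "real set \<Rightarrow> (real \<Rightarrow> real) \<Rightarrow> real \<Rightarrow> real" where
  "martingale_diff I \<phi> x =
     1 / 2 * (avg (right_half I) \<phi> - avg (left_half I) \<phi>)
       * (indicat_real (right_half I) x - indicat_real (left_half I) x)"

text \<open>The squared square function takes values in the extended non-negative reals, so that
  points where the series diverges satisfy every condition of the form
  ``at least \<open>l\<close>'' (an \<open>infsum\<close> in \<open>real\<close> would be \<open>0\<close> there).\<close>

definition square_fun_sq :: "real set \<Rightarrow> (real \<Rightarrow> real) \<Rightarrow> real \<Rightarrow> ennreal" where
  "square_fun_sq J \<phi> x =
     (\<Sum>\<^sub>\<infinity>I\<in>{I \<in> dyadic_intervals. I \<subseteq> J}.
        ennreal (\<bar>martingale_diff I \<phi> x\<bar>\<^sup>2 * indicat_real I x))"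

definition Omega_M :: "(real \<times> real \<times> real) set" where
  "Omega_M = {(f, F, l). \<bar>f\<bar> \<le> F \<and> l > 0}"

definition admissible :: "real set \<Rightarrow> real \<Rightarrow> real \<Rightarrow> (real \<Rightarrow> real) set" where
  "admissible J f F =
     {\<phi>. integrable lebesgue \<phi> \<and> (\<forall>x. x \<notin> J \<longrightarrow> \<phi> x = 0) \<and>
         avg J \<phi> = f \<and> avg J (\<lambda>x. \<bar>\<phi> x\<bar>) = F}"

text \<open>The Bellman function computed on a given dyadic interval \<open>J\<close>; by dilation and translation
  its value is the same for every choice of \<open>J\<close>.  For a point of \<^const>\<open>Omega_M\<close> the supremum is
  over a non-empty set (the function equal to \<open>f + F\<close> and \<open>f - F\<close> on the two halves of \<open>J\<close> is
  admissible) that is bounded above by \<open>1\<close>, so the real-valued supremum is the intended one.\<close>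

definition bellman_M :: "real set \<Rightarrow> real \<times> real \<times> real \<Rightarrow> real" where
  "bellman_M J = (\<lambda>(f, F, l).
     SUP \<phi>\<in>admissible J f F.
       1 / measure lebesgue J * measure lebesgue {x \<in> J. square_fun_sq J \<phi> x \<ge> ennreal l})"

text \<open>Only the values of \<open>m\<close> on \<^const>\<open>Omega_M\<close> are constrained.\<close>

definition supersolution :: "(real \<times> real \<times> real \<Rightarrow> real) \<Rightarrow> bool" where
  "supersolution m \<longleftrightarrow>
     (\<forall>p\<in>Omega_M. m p \<ge> 0) \<and>
     continuous_on Omega_M m \<and>
     (\<forall>f F l a b.
        (f, F, l + a\<^sup>2) \<in> Omega_M \<longrightarrow>
        (f + a, F + b, l) \<in> Omega_M \<longrightarrow>
        (f - a, F - b, l) \<in> Omega_M \<longrightarrow>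
        m (f, F, l + a\<^sup>2) \<ge> 1 / 2 * (m (f + a, F + b, l) + m (f - a, F - b, l))) \<and>
     (\<forall>f F l. (f, F, l) \<in> Omega_M \<longrightarrow> l \<le> F\<^sup>2 \<longrightarrow> m (f, F, l) = 1)"

end

theory Submission
  imports Defs
begin

text \<open>Truncate the square function to the first \<open>n\<close> dyadic generations. Splitting \<open>J\<close> into halves
  changes \<open>(f, F)\<close> to \<open>(f \<plusminus> a, F \<plusminus> b)\<close> and uses up the amount \<open>a\<^sup>2\<close> of the threshold
  \<open>\<lambda>\<close>, so the main inequality gives by induction on \<open>n\<close> that the normalized measure of
  \<open>{S\<^sub>n\<^sup>2 \<ge> \<lambda>}\<close> is at most \<open>m(f, F, \<lambda>)\<close>. The main inequality is unavailable only if
  \<open>\<lambda> \<le> a\<^sup>2\<close>; but \<open>\<bar>a\<bar> \<le> F\<close>, so then the obstacle condition gives \<open>m = 1\<close>. Since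
  \<open>{S\<^sup>2 \<ge> \<lambda>}\<close> lies in the increasing union of the sets \<open>{S\<^sub>n\<^sup>2 \<ge> \<mu>}\<close> for every \<open>\<mu> < \<lambda>\<close>,
  continuity of \<open>m\<close> in \<open>\<lambda>\<close> finishes the proof.\<close>

section \<open>Averages over half-open intervals\<close>

lemma left_half_interval:
  "a < b \<Longrightarrow> left_half {a..<b} = {a..<(a + b) / 2}"
  by (simp add: left_half_def)

lemma right_half_interval:
  "a < b \<Longrightarrow> right_half {a..<b} = {(a + b) / 2..<b}"
  by (simp add: right_half_def)

lemma avg_interval:
  "a < b \<Longrightarrow> avg {a..<b} \<phi> = (LINT x:{a..<b}|lebesgue. \<phi> x) / (b - a)"
  by (simp add: avg_def)

lemma set_integrable_lebesgue_interval:
  fixes \<phi> :: "real \<Rightarrow> real"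
  assumes "integrable lebesgue \<phi>"
  shows "set_integrable lebesgue {a..<b} \<phi>"
  using integrable_mult_indicator[OF _ assms, of "{a..<b}"] by (simp add: set_integrable_def)

text \<open>The halves have equal length, so the average is the midpoint of the two averages.
  Applied to \<phi> and to its absolute value, this produces the centre point of the main
  inequality.\<close>

lemma avg_halves:
  assumes "integrable lebesgue \<phi>" and "a < b"
  shows "avg {a..<b} \<phi> = (avg {a..<(a + b) / 2} \<phi> + avg {(a + b) / 2..<b} \<phi>) / 2"
proof -
  let ?c = "(a + b) / 2"
  have "{a..<b} = {a..<?c} \<union> {?c..<b}"
    using assms(2) by auto
  then have "(LINT x:{a..<b}|lebesgue. \<phi> x)
      = (LINT x:{a..<?c}|lebesgue. \<phi> x) + (LINT x:{?c..<b}|lebesgue. \<phi> x)"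
    using set_integral_Un[of "{a..<?c}" "{?c..<b}" lebesgue \<phi>]
      set_integrable_lebesgue_interval[OF assms(1)] by auto
  moreover have "a < ?c" "?c < b"
    using assms(2) by auto
  moreover have "?c - a = (b - a) / 2" "b - ?c = (b - a) / 2"
    by (simp_all add: field_simps)
  moreover have "(X + Y) / d = (X / (d / 2) + Y / (d / 2)) / 2" for X Y d :: real
    by (simp add: add_divide_distrib)
  ultimately show ?thesis
    using assms(2) by (simp only: avg_interval)
qed

text \<open>Keeps the pair of averages of \<phi> and of its absolute value in the region where
  \<open>m\<close> is constrained; with a positive threshold it gives a point of
  \<open>Omega_M\<close>.\<close>

lemma abs_avg_le:
  assumes "integrable lebesgue \<phi>" and "a < b"
  shows "\<bar>avg {a..<b} \<phi>\<bar> \<le> avg {a..<b} (\<lambda>x. \<bar>\<phi> x\<bar>)"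
proof -
  have "\<bar>LINT x:{a..<b}|lebesgue. \<phi> x\<bar> \<le> (LINT x:{a..<b}|lebesgue. \<bar>\<phi> x\<bar>)"
    using set_integral_norm_bound[OF set_integrable_lebesgue_interval[OF assms(1)]] by auto
  then show ?thesis
    using assms(2) by (simp add: avg_interval divide_right_mono)
qed

text \<open>A real-valued supremum can be bounded termwise only over a non-empty index set. The
  witness takes the value f + F >= 0 on the left half and f - F <= 0 on the right, so its absolute
  values F + f and F - f average to F.\<close>

lemma admissible_nonempty:
  assumes "a < b" and "\<bar>f\<bar> \<le> F"
  shows "admissible {a..<b} f F \<noteq> {}"
proof -
  let ?c = "(a + b) / 2"
  define \<phi> where "\<phi> x = (f + F) * indicat_real {a..<?c} x + (f - F) * indicat_real {?c..<b} x" for x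
  have c: "a < ?c" "?c < b"
    using assms(1) by auto
  then have int: "integrable lebesgue \<phi>"
    unfolding \<phi>_def by (intro Bochner_Integration.integrable_add integrable_mult_right
        integrable_real_indicator) auto
  have avg_const: "avg {u..<v} g = k" if "u < v" "\<And>x. x \<in> {u..<v} \<Longrightarrow> g x = k" for u v k g
  proof -
    have "(LINT x:{u..<v}|lebesgue. g x) = (LINT x:{u..<v}|lebesgue. k)"
      using that(2) by (intro set_lebesgue_integral_cong) auto
    then show ?thesis
      using that(1) by (simp add: avg_interval set_integral_const)
  qed
  have L: "\<phi> x = f + F" if "x \<in> {a..<?c}" for x
    using that by (auto simp: \<phi>_def indicator_def)
  have R: "\<phi> x = f - F" if "x \<in> {?c..<b}" for x
    using that by (auto simp: \<phi>_def indicator_def)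
  have "avg {a..<b} \<phi> = f"
    unfolding avg_halves[OF int assms(1)]
    using avg_const[OF c(1), of \<phi>, OF L] avg_const[OF c(2), of \<phi>, OF R] by simp
  moreover have "avg {a..<b} (\<lambda>x. \<bar>\<phi> x\<bar>) = F"
  proof -
    have "avg {a..<?c} (\<lambda>x. \<bar>\<phi> x\<bar>) = f + F"
      using L assms(2) by (intro avg_const[OF c(1)]) auto
    moreover have "avg {?c..<b} (\<lambda>x. \<bar>\<phi> x\<bar>) = F - f"
      using R assms(2) by (intro avg_const[OF c(2)]) auto
    ultimately show ?thesis
      unfolding avg_halves[OF integrable_abs[OF int] assms(1)] by simp
  qed
  moreover have "\<phi> x = 0" if "x \<notin> {a..<b}" for x
    using that c by (auto simp: \<phi>_def indicator_def)
  ultimately have "\<phi> \<in> admissible {a..<b} f F"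
    using int by (auto simp: admissible_def)
  then show ?thesis
    by blast
qed

section \<open>Truncation of the square function to finitely many generations\<close>

primrec descendants :: "nat \<Rightarrow> real set \<Rightarrow> real set set" where
  "descendants 0 J = {}"
| "descendants (Suc n) J = insert J (descendants n (left_half J) \<union> descendants n (right_half J))"

text \<open>The number \<open>n\<close> counts generations with \<open>J\<close> itself as the
  first, so \<open>n = 0\<close> gives the zero function. The sum is finite, hence real-valued, and
  has the same terms as \<open>square_fun_sq\<close>.\<close>

definition truncated_square_fun_sq :: "nat \<Rightarrow> real set \<Rightarrow> (real \<Rightarrow> real) \<Rightarrow> real \<Rightarrow> real" where
  "truncated_square_fun_sq n J \<phi> x =
     (\<Sum>I\<in>descendants n J. \<bar>martingale_diff I \<phi> x\<bar>\<^sup>2 * indicat_real I x)"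

lemma finite_descendants: "finite (descendants n J)"
  by (induction n arbitrary: J) auto

lemma descendants_interval:
  assumes "I \<in> descendants n {a..<b}" and "a < b"
  obtains c d where "I = {c..<d}" "c < d" "a \<le> c" "d \<le> b"
  using assms
proof (induction n arbitrary: a b thesis)
  case 0
  then show ?case by simp
next
  case (Suc n)
  let ?c = "(a + b) / 2"
  have c: "a < ?c" "?c < b"
    using Suc.prems(3) by auto
  consider "I = {a..<b}" | "I \<in> descendants n {a..<?c}" | "I \<in> descendants n {?c..<b}"
    using Suc.prems(2,3) by (auto simp: left_half_interval right_half_interval)
  then show ?case
  proof cases
    case 1
    then show ?thesis using Suc.prems(1,3) by blast
  next
    case 2
    obtain u v where "I = {u..<v}" "u < v" "a \<le> u" "v \<le> ?c"
      using Suc.IH[OF _ 2 c(1)] by blast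
    then show ?thesis using Suc.prems(1) c by fastforce
  next
    case 3
    obtain u v where "I = {u..<v}" "u < v" "?c \<le> u" "v \<le> b"
      using Suc.IH[OF _ 3 c(2)] by blast
    then show ?thesis using Suc.prems(1) c by fastforce
  qed
qed

lemma descendants_mono:
  "n \<le> k \<Longrightarrow> descendants n J \<subseteq> descendants k J"
proof (induction n arbitrary: J k)
  case (Suc n)
  then obtain k' where "k = Suc k'" "n \<le> k'"
    by (cases k) auto
  then show ?case
    using Suc.IH by fastforce
qed simp

lemma truncated_square_fun_sq_mono:
  "n \<le> k \<Longrightarrow> truncated_square_fun_sq n J \<phi> x \<le> truncated_square_fun_sq k J \<phi> x"
  unfolding truncated_square_fun_sq_def
  by (intro sum_mono2 finite_descendants descendants_mono) auto

lemma truncated_square_fun_sq_outside: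
  assumes "a < b" and "x \<notin> {a..<b}"
  shows "truncated_square_fun_sq n {a..<b} \<phi> x = 0"
  unfolding truncated_square_fun_sq_def
proof (intro sum.neutral ballI)
  fix I assume "I \<in> descendants n {a..<b}"
  then obtain c d where "I = {c..<d}" "a \<le> c" "d \<le> b"
    using assms(1) by (elim descendants_interval)
  then show "\<bar>martingale_diff I \<phi> x\<bar>\<^sup>2 * indicat_real I x = 0"
    using assms(2) by auto
qed

text \<open>Here \<phi> enters only through its averages, which are constants, so every term is a
  step function of \<open>x\<close>.\<close>

lemma borel_measurable_truncated_square_fun_sq:
  assumes "a < b"
  shows "truncated_square_fun_sq n {a..<b} \<phi> \<in> borel_measurable borel"
  unfolding truncated_square_fun_sq_def
proof (intro borel_measurable_sum)
  fix I assume "I \<in> descendants n {a..<b}"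
  then obtain c d where I: "I = {c..<d}" "c < d"
    using assms by (elim descendants_interval)
  then show "(\<lambda>x. \<bar>martingale_diff I \<phi> x\<bar>\<^sup>2 * indicat_real I x) \<in> borel_measurable borel"
    by (simp add: martingale_diff_def left_half_interval right_half_interval)
qed

lemma fmeasurable_truncated_superlevel:
  assumes "a < b"
  shows "{x \<in> {a..<b}. l \<le> truncated_square_fun_sq n {a..<b} \<phi> x} \<in> fmeasurable lebesgue"
proof -
  have "{x \<in> {a..<b}. l \<le> truncated_square_fun_sq n {a..<b} \<phi> x} \<in> sets borel"
    using borel_measurable_truncated_square_fun_sq[OF assms, of n \<phi>, measurable] by measurable
  then have "{x \<in> {a..<b}. l \<le> truncated_square_fun_sq n {a..<b} \<phi> x} \<in> sets lebesgue"
    by simp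
  moreover have "{a..<b} \<in> fmeasurable lebesgue"
    by (simp add: bounded_set_imp_lmeasurable)
  ultimately show ?thesis
    by (rule fmeasurableI2[rotated 2]) auto
qed

text \<open>Peels off the top interval. The terms are non-negative, so a sum over a union of
  families is at most the total of the separate sums; an upper bound suffices for the later
  inclusion of superlevel sets.\<close>

lemma truncated_square_fun_sq_Suc_le:
  assumes "a < b" and "x \<in> {a..<b}"
  defines "c \<equiv> (a + b) / 2"
  shows "truncated_square_fun_sq (Suc n) {a..<b} \<phi> x
    \<le> ((avg {c..<b} \<phi> - avg {a..<c} \<phi>) / 2)\<^sup>2
      + (truncated_square_fun_sq n {a..<c} \<phi> x + truncated_square_fun_sq n {c..<b} \<phi> x)"
proof -
  define g where "g I = \<bar>martingale_diff I \<phi> x\<bar>\<^sup>2 * indicat_real I x" for I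
  let ?D = "(avg {c..<b} \<phi> - avg {a..<c} \<phi>) / 2"
  have halves: "left_half {a..<b} = {a..<c}" "right_half {a..<b} = {c..<b}"
    using assms(1) by (simp_all add: left_half_interval right_half_interval c_def)
  \<comment> \<open>The sign depends on the half that contains \<open>x\<close>, but the square is
    constant on the whole interval.\<close>
  have "martingale_diff {a..<b} \<phi> x = ?D \<or> martingale_diff {a..<b} \<phi> x = - ?D"
    using assms(2) by (cases "x < c") (simp_all add: martingale_diff_def halves indicator_def)
  then have "(martingale_diff {a..<b} \<phi> x)\<^sup>2 = ?D\<^sup>2"
    by (metis power2_minus)
  then have g: "g {a..<b} = ?D\<^sup>2"
    using assms(2) by (simp add: g_def)
  let ?L = "descendants n {a..<c}" and ?R = "descendants n {c..<b}"
  have nonneg: "0 \<le> g I" for I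
    by (simp add: g_def)
  have "sum g (insert {a..<b} (?L \<union> ?R)) \<le> g {a..<b} + sum g (?L \<union> ?R)"
    using nonneg[of "{a..<b}"] by (simp add: sum.insert_if finite_descendants)
  also have "sum g (?L \<union> ?R) \<le> sum g ?L + sum g ?R"
    using sum_nonneg[of "?L \<inter> ?R" g] nonneg by (simp add: sum_Un finite_descendants)
  finally show ?thesis
    unfolding truncated_square_fun_sq_def descendants.simps halves g g_def[symmetric] by simp
qed

section \<open>Bellman induction on the number of generations\<close>

lemma supersolution_nonneg:
  "supersolution m \<Longrightarrow> \<bar>f\<bar> \<le> F \<Longrightarrow> 0 < l \<Longrightarrow> 0 \<le> m (f, F, l)"
  by (auto simp: supersolution_def Omega_M_def)

lemma supersolution_obstacle:
  "supersolution m \<Longrightarrow> \<bar>f\<bar> \<le> F \<Longrightarrow> 0 < l \<Longrightarrow> l \<le> F\<^sup>2 \<Longrightarrow> m (f, F, l) = 1"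
  by (auto simp: supersolution_def Omega_M_def)

text \<open>The main inequality in terms of its two outer points: a = (f2 - f1) / 2 and b = (F2 -
  F1) / 2, with centre at their midpoint. The strict bound on a^2 keeps the reduced threshold
  positive.\<close>

lemma supersolution_midpoint:
  assumes "supersolution m" and "\<bar>f1\<bar> \<le> F1" and "\<bar>f2\<bar> \<le> F2" and "((f2 - f1) / 2)\<^sup>2 < l"
  shows "(m (f1, F1, l - ((f2 - f1) / 2)\<^sup>2) + m (f2, F2, l - ((f2 - f1) / 2)\<^sup>2)) / 2
    \<le> m ((f1 + f2) / 2, (F1 + F2) / 2, l)"
proof -
  define a where "a = (f2 - f1) / 2"
  define b where "b = (F2 - F1) / 2"
  have main: "(f, F, l + a\<^sup>2) \<in> Omega_M \<Longrightarrow> (f + a, F + b, l) \<in> Omega_M \<Longrightarrow>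
      (f - a, F - b, l) \<in> Omega_M \<Longrightarrow>
      m (f, F, l + a\<^sup>2) \<ge> 1 / 2 * (m (f + a, F + b, l) + m (f - a, F - b, l))" for f F l
    using assms(1) by (auto simp: supersolution_def)
  have "(f1 + f2) / 2 + a = f2" "(f1 + f2) / 2 - a = f1"
    "(F1 + F2) / 2 + b = F2" "(F1 + F2) / 2 - b = F1"
    by (auto simp: a_def b_def field_simps)
  moreover have "0 < l - a\<^sup>2" "0 < l"
    using assms(4) by (auto simp: a_def intro: le_less_trans[OF zero_le_power2])
  moreover have "\<bar>f1 + f2\<bar> \<le> F1 + F2"
    using assms(2,3) by (intro order_trans[OF abs_triangle_ineq] add_mono)
  then have "\<bar>(f1 + f2) / 2\<bar> \<le> (F1 + F2) / 2"
    by (simp add: abs_divide)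
  ultimately show ?thesis
    using main[of "(f1 + f2) / 2" "(F1 + F2) / 2" "l - a\<^sup>2"] assms(2,3)
    by (simp add: Omega_M_def add.commute flip: a_def)
qed

text \<open>The bound is multiplied by the length instead of normalized, so that the estimates for
  the two halves simply add. The endpoints and the threshold vary in the induction because both
  change when passing to a half.\<close>

lemma truncated_superlevel_le_supersolution:
  assumes "supersolution m" and "integrable lebesgue \<phi>" and "a < b" and "0 < l"
  shows "measure lebesgue {x \<in> {a..<b}. l \<le> truncated_square_fun_sq n {a..<b} \<phi> x}
    \<le> (b - a) * m (avg {a..<b} \<phi>, avg {a..<b} (\<lambda>x. \<bar>\<phi> x\<bar>), l)"
  using assms(3,4)
proof (induction n arbitrary: a b l)
  case 0
  then have "{x \<in> {a..<b}. l \<le> truncated_square_fun_sq 0 {a..<b} \<phi> x} = {}"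
    by (auto simp: truncated_square_fun_sq_def)
  then show ?case
    using supersolution_nonneg[OF assms(1) abs_avg_le[OF assms(2) 0(1)] 0(2)] 0(1)
    by (simp only: measure_empty) simp
next
  case (Suc n)
  let ?T = "truncated_square_fun_sq" and ?\<psi> = "\<lambda>x. \<bar>\<phi> x\<bar>"
  define c where "c = (a + b) / 2"
  define \<alpha> where "\<alpha> = (avg {c..<b} \<phi> - avg {a..<c} \<phi>) / 2"
  note ab = \<open>a < b\<close>
  have c: "a < c" "c < b" "c - a = (b - a) / 2" "b - c = (b - a) / 2"
    using ab by (auto simp: c_def field_simps)
  note L = abs_avg_le[OF assms(2) c(1)] and R = abs_avg_le[OF assms(2) c(2)]
  have \<phi>: "avg {a..<b} \<phi> = (avg {a..<c} \<phi> + avg {c..<b} \<phi>) / 2"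
    unfolding c_def by (rule avg_halves[OF assms(2) ab])
  have \<psi>: "avg {a..<b} ?\<psi> = (avg {a..<c} ?\<psi> + avg {c..<b} ?\<psi>) / 2"
    unfolding c_def by (rule avg_halves[OF integrable_abs[OF assms(2)] ab])
  let ?E = "{x \<in> {a..<b}. l \<le> ?T (Suc n) {a..<b} \<phi> x}"
  have E: "?E \<in> fmeasurable lebesgue"
    by (rule fmeasurable_truncated_superlevel[OF ab])
  show ?case
  proof (cases "l \<le> \<alpha>\<^sup>2")
    case True
    \<comment> \<open>Half of this bound is |\<alpha>| <= F, where F is the average of the absolute
      value over the whole interval. Hence l <= \<alpha>^2 <= F^2, which is the obstacle
      region.\<close>
    have "\<bar>avg {c..<b} \<phi> - avg {a..<c} \<phi>\<bar> \<le> avg {c..<b} ?\<psi> + avg {a..<c} ?\<psi>"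
      using L R by (intro order_trans[OF abs_triangle_ineq4] add_mono)
    then have "\<bar>\<alpha>\<bar> \<le> avg {a..<b} ?\<psi>"
      by (simp add: \<psi> \<alpha>_def abs_divide add.commute)
    then have "\<alpha>\<^sup>2 \<le> (avg {a..<b} ?\<psi>)\<^sup>2"
      by (metis abs_ge_zero power2_abs power_mono)
    then have "m (avg {a..<b} \<phi>, avg {a..<b} ?\<psi>, l) = 1"
      using True by (intro supersolution_obstacle assms abs_avg_le Suc.prems) auto
    moreover have "measure lebesgue ?E \<le> measure lebesgue {a..<b}"
      using E by (intro measure_mono_fmeasurable) (auto simp: bounded_set_imp_lmeasurable)
    ultimately show ?thesis
      using ab by simp
  next
    case False
    let ?EL = "{x \<in> {a..<c}. l - \<alpha>\<^sup>2 \<le> ?T n {a..<c} \<phi> x}"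
    let ?ER = "{x \<in> {c..<b}. l - \<alpha>\<^sup>2 \<le> ?T n {c..<b} \<phi> x}"
    have F: "?EL \<in> fmeasurable lebesgue" "?ER \<in> fmeasurable lebesgue"
      by (rule fmeasurable_truncated_superlevel[OF c(1)] fmeasurable_truncated_superlevel[OF c(2)])+
    have "?E \<subseteq> ?EL \<union> ?ER"
    proof
      fix x assume x: "x \<in> ?E"
      then have *: "l \<le> \<alpha>\<^sup>2 + (?T n {a..<c} \<phi> x + ?T n {c..<b} \<phi> x)"
        using truncated_square_fun_sq_Suc_le[OF ab, of x n \<phi>] by (auto simp: c_def \<alpha>_def)
      \<comment> \<open>The truncated function of the half that does not contain \<open>x\<close>
        vanishes at \<open>x\<close>, so the other one must supply the remaining l -
        \<alpha>^2.\<close>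
      show "x \<in> ?EL \<union> ?ER"
      proof (cases "x < c")
        case True
        then show ?thesis
          using * x truncated_square_fun_sq_outside[OF c(2), of x n \<phi>] by auto
      next
        case False
        then show ?thesis
          using * x truncated_square_fun_sq_outside[OF c(1), of x n \<phi>] by auto
      qed
    qed
    then have "measure lebesgue ?E \<le> measure lebesgue (?EL \<union> ?ER)"
      using E F by (intro measure_mono_fmeasurable) auto
    also have "\<dots> \<le> measure lebesgue ?EL + measure lebesgue ?ER"
      using F by (intro measure_Un_le) auto
    also have "\<dots> \<le> (c - a) * m (avg {a..<c} \<phi>, avg {a..<c} ?\<psi>, l - \<alpha>\<^sup>2)
        + (b - c) * m (avg {c..<b} \<phi>, avg {c..<b} ?\<psi>, l - \<alpha>\<^sup>2)"
      using False c by (intro add_mono Suc.IH) auto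
    also have "\<dots> = (b - a) * ((m (avg {a..<c} \<phi>, avg {a..<c} ?\<psi>, l - \<alpha>\<^sup>2)
        + m (avg {c..<b} \<phi>, avg {c..<b} ?\<psi>, l - \<alpha>\<^sup>2)) / 2)"
      unfolding c(3,4) by (simp add: add_divide_distrib distrib_left)
    also have "\<dots> \<le> (b - a) * m (avg {a..<b} \<phi>, avg {a..<b} ?\<psi>, l)"
      using supersolution_midpoint[OF assms(1) L R, of l] False ab
      unfolding \<phi> \<psi> \<alpha>_def by (intro mult_left_mono) auto
    finally show ?thesis .
  qed
qed

section \<open>Dyadic subintervals as descendants\<close>

abbreviation dyadic :: "int \<Rightarrow> int \<Rightarrow> real set" where
  "dyadic k n \<equiv> {of_int k * 2 powi n ..< (of_int k + 1) * 2 powi n}"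

lemma dyadic_less: "of_int k * 2 powi n < (of_int k + 1) * (2 powi n :: real)"
  by (simp add: distrib_right)

text \<open>Rewrites endpoints and midpoint at the next finer scale, so that both halves take the
  form of dyadic intervals.\<close>

lemma dyadic_midpoint:
  "(of_int k * 2 powi n + (of_int k + 1) * 2 powi n) / 2 = (2 * of_int k + 1) * (2 powi (n - 1) :: real)"
  "of_int k * 2 powi n = 2 * of_int k * (2 powi (n - 1) :: real)"
proof -
  have n: "2 powi n = 2 * (2 powi (n - 1) :: real)"
    by (simp add: power_int_diff)
  show "(of_int k * 2 powi n + (of_int k + 1) * 2 powi n) / 2 = (2 * of_int k + 1) * (2 powi (n - 1) :: real)"
    unfolding n by (simp add: field_simps)
  show "of_int k * 2 powi n = 2 * of_int k * (2 powi (n - 1) :: real)"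
    unfolding n by simp
qed

lemma left_half_dyadic: "left_half (dyadic k n) = dyadic (2 * k) (n - 1)"
  unfolding left_half_interval[OF dyadic_less] dyadic_midpoint(1)
  by (simp add: dyadic_midpoint(2))

lemma right_half_dyadic: "right_half (dyadic k n) = dyadic (2 * k + 1) (n - 1)"
  unfolding right_half_interval[OF dyadic_less] dyadic_midpoint(1)
  using dyadic_midpoint(2)[of "k + 1" n] by (simp add: add.assoc distrib_left)

text \<open>The hypotheses express containment in units of 2^n. Comparing \<open>k\<close> with the
  midpoint (2j + 1) 2^d selects the half for the induction. Descending \<open>d\<close> levels takes
  \<open>Suc d\<close> generations, as the top interval counts as one.\<close>

lemma dyadic_mem_descendants:
  assumes "j * 2 ^ d \<le> k" and "k < (j + 1) * 2 ^ d"
  shows "dyadic k n \<in> descendants (Suc d) (dyadic j (n + int d))"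
  using assms
proof (induction d arbitrary: j)
  case 0
  then have "k = j" by simp
  then show ?case by simp
next
  case (Suc d)
  have half: "dyadic k n \<in> descendants (Suc d) (dyadic i (n + int d))"
    if "i * 2 ^ d \<le> k" "k < (i + 1) * 2 ^ d" for i
    using Suc.IH that by blast
  have eq: "n + int (Suc d) - 1 = n + int d" by simp
  show ?case
  proof (cases "k < (2 * j + 1) * 2 ^ d")
    case True
    then have "dyadic k n \<in> descendants (Suc d) (left_half (dyadic j (n + int (Suc d))))"
      unfolding left_half_dyadic eq using Suc.prems by (intro half) (auto simp: algebra_simps)
    then show ?thesis
      by (subst descendants.simps) blast
  next
    case False
    then have "dyadic k n \<in> descendants (Suc d) (right_half (dyadic j (n + int (Suc d))))"
      unfolding right_half_dyadic eq using Suc.prems by (intro half) (auto simp: algebra_simps)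
    then show ?thesis
      by (subst descendants.simps) blast
  qed
qed

text \<open>Containment compares lengths and gives n <= p. Dividing the endpoint inequalities by 2^n
  then leaves integers, where k + 1 <= (j + 1) 2^d is the required strict bound on
  \<open>k\<close>.\<close>

lemma dyadic_subinterval_mem_descendants:
  assumes "I \<in> dyadic_intervals" and "J \<in> dyadic_intervals" and "I \<subseteq> J"
  obtains n where "I \<in> descendants n J"
proof -
  obtain k n j p where I: "I = dyadic k n" and J: "J = dyadic j p"
    using assms(1,2) by (auto simp: dyadic_intervals_def)
  have sub: "of_int j * 2 powi p \<le> of_int k * (2 powi n :: real)"
    "(of_int k + 1) * 2 powi n \<le> (of_int j + 1) * (2 powi p :: real)"
    using assms(3) dyadic_less[of k n] unfolding I J by (auto simp: atLeastLessThan_subset_iff)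
  then have "2 powi n \<le> (2 powi p :: real)"
    by (simp add: algebra_simps)
  then have "n \<le> p"
    using power_int_strict_increasing[of p n "2::real"] by (simp add: linorder_not_le[symmetric]) argo
  then obtain d where p: "p = n + int d"
    using zle_iff_zadd by auto
  have pow: "2 powi p = 2 ^ d * (2 powi n :: real)"
    by (simp add: p power_int_add)
  have "real_of_int j * 2 ^ d \<le> of_int k" "of_int k + 1 \<le> (real_of_int j + 1) * 2 ^ d"
    using sub unfolding pow by (simp_all flip: mult.assoc)
  then have "real_of_int (j * 2 ^ d) \<le> of_int k" "real_of_int (k + 1) \<le> of_int ((j + 1) * 2 ^ d)"
    by simp_all
  then have "j * 2 ^ d \<le> k" "k + 1 \<le> (j + 1) * 2 ^ d"
    by (simp_all only: of_int_le_iff)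
  then have "I \<in> descendants (Suc d) J"
    unfolding I J p using dyadic_mem_descendants[of j d k n] by simp
  then show thesis
    by (rule that)
qed

lemma finite_dyadic_subset_descendants:
  assumes "finite G" and "G \<subseteq> {I \<in> dyadic_intervals. I \<subseteq> J}" and "J \<in> dyadic_intervals"
  obtains n where "G \<subseteq> descendants n J"
proof -
  have "\<forall>I\<in>G. \<exists>n. I \<in> descendants n J"
    using assms(2) by (blast intro: dyadic_subinterval_mem_descendants[OF _ assms(3)])
  then obtain N where N: "\<And>I. I \<in> G \<Longrightarrow> I \<in> descendants (N I) J"
    by metis
  \<comment> \<open>The families increase with the generation count, so the largest index serves all
    of \<open>G\<close>. For empty \<open>G\<close> the inclusion is trivial, whatever
    \<open>Max {}\<close> is.\<close>
  have "G \<subseteq> descendants (Max (N ` G)) J"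
    using N descendants_mono[OF Max_ge] assms(1) by blast
  then show thesis
    by (rule that)
qed

section \<open>From truncated sums to the full square function\<close>

lemma less_square_fun_sq_imp_truncated:
  assumes "J \<in> dyadic_intervals" and "ennreal l < square_fun_sq J \<phi> x"
  obtains n where "l \<le> truncated_square_fun_sq n J \<phi> x"
proof -
  let ?D = "{I \<in> dyadic_intervals. I \<subseteq> J}"
  let ?g = "\<lambda>I. \<bar>martingale_diff I \<phi> x\<bar>\<^sup>2 * indicat_real I x"
  have "square_fun_sq J \<phi> x = (SUP G\<in>{G. finite G \<and> G \<subseteq> ?D}. \<Sum>I\<in>G. ennreal (?g I))"
    unfolding square_fun_sq_def by (rule nonneg_infsum_complete) simp
  \<comment> \<open>Strictness matters: a value strictly below the supremum is exceeded by one
    finite partial sum, whereas the supremum itself need not be attained.\<close>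
  then obtain G where G: "finite G" "G \<subseteq> ?D" "ennreal l < (\<Sum>I\<in>G. ennreal (?g I))"
    using assms(2) by (auto simp: less_SUP_iff)
  obtain n where n: "G \<subseteq> descendants n J"
    using finite_dyadic_subset_descendants[OF G(1,2) assms(1)] .
  have "ennreal l < ennreal (sum ?g G)"
    using G(3) by (subst (asm) sum_ennreal) auto
  then have "l < sum ?g G"
    using ennreal_leI[of "sum ?g G" l] by (meson not_le)
  also have "\<dots> \<le> truncated_square_fun_sq n J \<phi> x"
    unfolding truncated_square_fun_sq_def using n by (intro sum_mono2 finite_descendants) auto
  finally show thesis
    using that by (metis less_imp_le)
qed

text \<open>The full series may reach \<open>l\<close> only in the limit. Lowering the threshold to
  \<mu> puts each point of the superlevel set into some \<open>E n\<close>, and the uniform bound on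
  these increasing sets passes to their union.\<close>

lemma square_fun_superlevel_le_supersolution:
  assumes "supersolution m" and "integrable lebesgue \<phi>" and "J \<in> dyadic_intervals"
    and "J = {a..<b}" and "a < b" and "0 < \<mu>" and "\<mu> < l"
  shows "measure lebesgue {x \<in> J. ennreal l \<le> square_fun_sq J \<phi> x}
    \<le> (b - a) * m (avg J \<phi>, avg J (\<lambda>x. \<bar>\<phi> x\<bar>), \<mu>)"
proof (cases "{x \<in> J. ennreal l \<le> square_fun_sq J \<phi> x} \<in> sets lebesgue")
  case True
  define E where "E n = {x \<in> J. \<mu> \<le> truncated_square_fun_sq n J \<phi> x}" for n
  let ?B = "(b - a) * m (avg J \<phi>, avg J (\<lambda>x. \<bar>\<phi> x\<bar>), \<mu>)"
  have E: "E n \<in> fmeasurable lebesgue" for n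
    unfolding E_def assms(4) by (rule fmeasurable_truncated_superlevel[OF assms(5)])
  have "incseq E"
    unfolding E_def by (intro monoI) (auto intro: order_trans[OF _ truncated_square_fun_sq_mono])
  moreover have bound: "measure lebesgue (E n) \<le> ?B" for n
    unfolding E_def assms(4)
    by (rule truncated_superlevel_le_supersolution[OF assms(1,2,5,6)])
  have J: "J \<in> fmeasurable lebesgue"
    by (simp add: assms(4) bounded_set_imp_lmeasurable)
  have U: "(\<Union>n. E n) \<in> fmeasurable lebesgue"
    by (rule fmeasurableI2[OF J]) (use E in \<open>auto simp: E_def\<close>)
  ultimately have lim: "(\<lambda>n. measure lebesgue (E n)) \<longlonglongrightarrow> measure lebesgue (\<Union>n. E n)"
    using E fmeasurableD2[OF U] by (intro Lim_measure_incseq) auto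
  have "{x \<in> J. ennreal l \<le> square_fun_sq J \<phi> x} \<subseteq> (\<Union>n. E n)"
  proof
    fix x assume x: "x \<in> {x \<in> J. ennreal l \<le> square_fun_sq J \<phi> x}"
    have "ennreal \<mu> < ennreal l"
      using assms(6,7) by (intro ennreal_lessI) auto
    also have "\<dots> \<le> square_fun_sq J \<phi> x"
      using x by simp
    finally obtain n where "\<mu> \<le> truncated_square_fun_sq n J \<phi> x"
      using less_square_fun_sq_imp_truncated[OF assms(3)] by blast
    then show "x \<in> (\<Union>n. E n)"
      using x by (auto simp: E_def)
  qed
  then have "measure lebesgue {x \<in> J. ennreal l \<le> square_fun_sq J \<phi> x} \<le> measure lebesgue (\<Union>n. E n)"
    by (intro measure_mono_fmeasurable True U)
  also have "\<dots> \<le> ?B"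
    using lim bound by (intro LIMSEQ_le_const2) auto
  finally show ?thesis .
next
  case False
  \<comment> \<open>\<open>measure\<close> is 0 on a non-measurable set, so only non-negativity of
    the right-hand side remains.\<close>
  then show ?thesis
    using supersolution_nonneg[OF assms(1) abs_avg_le[OF assms(2,5)] assms(6)] assms(4,5)
    by (simp add: measure_notin_sets)
qed

text \<open>The limit is taken from the left because the estimate holds for thresholds \<mu> < l.
  The ray of positive thresholds is open, so continuity on it is continuity at
  \<open>l\<close>.\<close>

lemma supersolution_tendsto_threshold:
  assumes "supersolution m" and "\<bar>f\<bar> \<le> F" and "0 < l"
  shows "((\<lambda>\<mu>. m (f, F, \<mu>)) \<longlongrightarrow> m (f, F, l)) (at_left l)"
proof -
  have "continuous_on {0<..} (\<lambda>\<mu>. m (f, F, \<mu>))"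
  proof (rule continuous_on_compose2[of Omega_M m])
    show "continuous_on Omega_M m"
      using assms(1) by (simp add: supersolution_def)
  qed (use assms(2) in \<open>auto simp: Omega_M_def intro!: continuous_intros\<close>)
  then have "isCont (\<lambda>\<mu>. m (f, F, \<mu>)) l"
    using assms(3) by (simp add: continuous_on_eq_continuous_at)
  then show ?thesis
    unfolding isCont_def by (rule filterlim_mono) (auto simp: at_le)
qed

theorem theorem2p3:
  fixes m :: "real \<times> real \<times> real \<Rightarrow> real"
  assumes "supersolution m"
  shows "\<forall>J\<in>dyadic_intervals. \<forall>p\<in>Omega_M. bellman_M J p \<le> m p"
proof (intro ballI)
  fix J p assume J: "J \<in> dyadic_intervals" and "p \<in> Omega_M"
  then obtain f F l where p: "p = (f, F, l)" and fF: "\<bar>f\<bar> \<le> F" and l: "0 < l"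
    by (auto simp: Omega_M_def)
  obtain k n where "J = dyadic k n"
    using J by (auto simp: dyadic_intervals_def)
  then obtain a b where ab: "J = {a..<b}" "a < b"
    using dyadic_less by blast
  have "1 / measure lebesgue J * measure lebesgue {x \<in> J. ennreal l \<le> square_fun_sq J \<phi> x}
      \<le> m (f, F, l)" if \<phi>: "\<phi> \<in> admissible J f F" for \<phi>
  \<comment> \<open>The left-hand side does not depend on \<mu>, so a bound by
    \<open>m (f, F, \<mu>)\<close> for all \<mu> in (0, l) survives the limit.\<close>
  proof (rule tendsto_lowerbound[OF supersolution_tendsto_threshold[OF assms fF l]])
    have "\<forall>\<^sub>F \<mu> in at_left l. \<mu> \<in> {0<..<l}"
      using eventually_at_left_real[OF l] .
    then show "\<forall>\<^sub>F \<mu> in at_left l. 1 / measure lebesgue J *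
        measure lebesgue {x \<in> J. ennreal l \<le> square_fun_sq J \<phi> x} \<le> m (f, F, \<mu>)"
    proof eventually_elim
      case (elim \<mu>)
      have "measure lebesgue {x \<in> J. ennreal l \<le> square_fun_sq J \<phi> x} \<le> (b - a) * m (f, F, \<mu>)"
        using square_fun_superlevel_le_supersolution[OF assms _ J ab, of \<phi> \<mu> l] \<phi> elim
        by (auto simp: admissible_def)
      moreover have "measure lebesgue J = b - a"
        using ab by simp
      ultimately show ?case
        using ab(2) by (simp add: divide_le_eq mult.commute)
    qed
  qed simp
  moreover have "admissible J f F \<noteq> {}"
    unfolding ab(1) by (rule admissible_nonempty[OF ab(2) fF])
  ultimately show "bellman_M J p \<le> m p"
    unfolding bellman_M_def p by (auto intro!: cSUP_least)
qed

end
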